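(* Let $T$ be a tree of order $n\ge4$ which is not isomorphic to the star $K_{1,n-1}$. Then the eigenvalues of $\mathcal{E}(T^c)$ are symmetric about the origin: if $\lambda$ is an eigenvalue of $\mathcal{E}(T^c)$ with multiplicity $k$, then $-\lambda$ is also an eigenvalue of $\mathcal{E}(T^c)$ with multiplicity $k$.
   Context: For a connected graph $G$, the eccentricity matrix $\mathcal{E}(G)$ is the matrix indexed by $V(G)$ whose $(u,v)$-entry is $d_G(u,v)$ if $d_G(u,v)=\min\{e_G(u),e_G(v)\}$ and $0$ otherwise, where $d_G$ is the graph distance and $e_G(u)=\max_v d_G(u,v)$. $T^c$ is the complement of $T$. *)

theory Defs
  imports
    "Graph_Theory.Graph_Theory"
    "Jordan_Normal_Form.Char_Poly"
begin

text \<open>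
  As in \<open>Graph_Theory\<close>, a finite simple undirected graph is a finite loop-free symmetric digraph
  without parallel arcs (\<open>pair_graph\<close>). In this encoding every edge gives a directed cycle
  \<open>u, v, u\<close>, so the predicate \<open>tree\<close> of that library does not describe undirected trees.
  The cycles of the undirected graph are the cycles with at least three arcs.
\<close>

definition undirected_tree :: "('a, 'b) pre_digraph \<Rightarrow> bool" where
  "undirected_tree G \<longleftrightarrow>
     graph G \<and> Digraph_Component.connected G \<and>
     \<not> (\<exists>p. pre_digraph.cycle G p \<and> 3 \<le> length p)"

definition complement_graph :: "'a pair_pre_digraph \<Rightarrow> 'a pair_pre_digraph" where
  "complement_graph G =
     \<lparr> pverts = pverts G,
       parcs = {(u, v). u \<in> pverts G \<and> v \<in> pverts G \<and> u \<noteq> v \<and> (u, v) \<notin> parcs G} \<rparr>"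

text \<open>
  The distance and everything derived from it is meant for connected graphs:
  \<open>\<mu>\<close> is \<open>\<infinity>\<close> between vertices of different components, and \<open>real_of_ereal \<infinity> = 0\<close>.
\<close>

definition graph_dist :: "('a, 'b) pre_digraph \<Rightarrow> 'a \<Rightarrow> 'a \<Rightarrow> real" where
  "graph_dist G u v = real_of_ereal (wf_digraph.\<mu> G (\<lambda>_. 1) u v)"

definition eccentricity :: "('a, 'b) pre_digraph \<Rightarrow> 'a \<Rightarrow> real" where
  "eccentricity G u = Max (graph_dist G u ` verts G)"

definition ecc_entry :: "('a, 'b) pre_digraph \<Rightarrow> 'a \<Rightarrow> 'a \<Rightarrow> real" where
  "ecc_entry G u v =
     (if graph_dist G u v = min (eccentricity G u) (eccentricity G v)
      then graph_dist G u v else 0)"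

text \<open>
  Matrices are indexed by initial segments of the naturals, so the vertices are listed by \<open>vs\<close>,
  which is meant to enumerate \<open>verts G\<close> without repetition.
\<close>

definition ecc_matrix :: "('a, 'b) pre_digraph \<Rightarrow> 'a list \<Rightarrow> real mat" where
  "ecc_matrix G vs = mat (length vs) (length vs) (\<lambda>(i, j). ecc_entry G (vs ! i) (vs ! j))"

end

theory Submission
  imports Defs
begin

text \<open>
  Every vertex of \<open>T\<close> has a neighbour in \<open>T\<close>, and as \<open>T\<close> is not a star, the two ends of an edge of
  \<open>T\<close> are still joined by a path in \<open>T\<^sup>c\<close>. So all eccentricities in \<open>T\<^sup>c\<close> are at least 2, whereas
  two vertices not adjacent in \<open>T\<close> have distance at most 1 in \<open>T\<^sup>c\<close>: the eccentricity matrix \<open>A\<close> of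
  \<open>T\<^sup>c\<close> is supported on the edges of \<open>T\<close>. A 2-colouring of \<open>T\<close> then gives a diagonal matrix \<open>D\<close> with
  entries \<open>\<plusminus>1\<close> and \<open>D A D = - A\<close>, so the characteristic polynomial is even or odd.
\<close>

section \<open>Root orders and characteristic polynomials under negating the variable\<close>

lemma order_le_order_pcompose_uminus:
  fixes p :: "'a :: idom poly"
  assumes "p \<noteq> 0"
  shows "Polynomial.order a p \<le> Polynomial.order (- a) (p \<circ>\<^sub>p [:0, - 1:])"
proof -
  obtain q where q: "p = [:- a, 1:] ^ Polynomial.order a p * q"
    using order_1[of a p] by (elim dvdE)
  \<comment> \<open>Substituting \<open>- x\<close> turns each factor \<open>x - a\<close> into
    \<open>- (x + a)\<close>, so the power of \<open>x - a\<close> dividing \<open>p\<close> yields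
    the same power of \<open>x + a\<close>.\<close>
  have "[:- a, 1:] \<circ>\<^sub>p [:0, - 1:] = - [:- (- a), 1:]"
    by (simp add: pcompose_pCons)
  then have "p \<circ>\<^sub>p [:0, - 1:] =
      (- [:- (- a), 1:]) ^ Polynomial.order a p * (q \<circ>\<^sub>p [:0, - 1:])"
    by (subst q) (simp only: pcompose_hom.hom_mult pcompose_hom.hom_power)
  then have "[:- (- a), 1:] ^ Polynomial.order a p dvd p \<circ>\<^sub>p [:0, - 1:]"
    using power_minus[of "[:- (- a), 1:]" "Polynomial.order a p"]
    by (simp only: dvd_mult2 dvd_triv_right)
  moreover have "p \<circ>\<^sub>p [:0, - 1:] \<noteq> 0"
    using assms by (simp add: pcompose_eq_0_iff)
  ultimately show ?thesis
    using order_divides by blast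
qed

text \<open>The preceding inequality, read at \<open>a\<close> and at \<open>- a\<close>, bounds
  each order by the other, since a nonzero scalar does not change orders.\<close>

lemma order_uminus_eq:
  fixes p :: "'a :: idom poly"
  assumes "p \<circ>\<^sub>p [:0, - 1:] = Polynomial.smult s p" "s \<noteq> 0" "p \<noteq> 0"
  shows "Polynomial.order (- a) p = Polynomial.order a p"
  using order_le_order_pcompose_uminus[OF assms(3), of a]
    order_le_order_pcompose_uminus[OF assms(3), of "- a"]
  by (simp add: assms order_smult)

text \<open>Conjugation by the sign matrix \<open>D\<close> fixes \<open>x I\<close> and negates
  \<open>A\<close>, so \<open>- x I - A\<close> is \<open>- D (x I - A) D\<close>. Taking
  determinants leaves the factor \<open>(- 1) ^ n\<close>.\<close>

lemma char_poly_pcompose_uminus: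
  fixes A :: "'a :: idom mat" and c :: "nat \<Rightarrow> bool"
  assumes A: "A \<in> carrier_mat n n"
    and c: "\<And>i j. i < n \<Longrightarrow> j < n \<Longrightarrow> A $$ (i, j) \<noteq> 0 \<Longrightarrow> c i \<noteq> c j"
  shows "char_poly A \<circ>\<^sub>p [:0, - 1:] = Polynomial.smult ((- 1) ^ n) (char_poly A)"
proof -
  define d :: "nat \<Rightarrow> 'a poly" where "d i = (if c i then 1 else - 1)" for i
  define D where "D = mat_diag n d"
  define M where "M = char_poly_matrix A"
  have D: "D \<in> carrier_mat n n" and M: "M \<in> carrier_mat n n"
    using A by (auto simp: D_def M_def)
  have DM: "D * M \<in> carrier_mat n n"
    using D M by simp
  have DMD: "D * M * D = mat n n (\<lambda>(i, j). d i * M $$ (i, j) * d j)"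
    unfolding D_def
    by (subst mat_diag_mult_left[OF M], subst mat_diag_mult_right) auto
  \<comment> \<open>The sign of \<open>det D\<close> depends on the colouring, but its square is 1
    because \<open>D\<close> is its own inverse.\<close>
  have "D * D = 1\<^sub>m n"
    unfolding D_def mat_diag_diag by (auto simp: mat_diag_def d_def intro!: eq_matI)
  then have detD: "det D * det D = 1"
    using det_mult[OF D D] by simp
  have M_index: "M $$ (i, j) = (if i = j then [:0, 1:] else 0) + [:- A $$ (i, j):]"
    if "i < n" "j < n" for i j
    using A that by (simp add: M_def char_poly_matrix_def)
  have "map_mat (\<lambda>q. q \<circ>\<^sub>p [:0, - 1:]) M = (- 1) \<cdot>\<^sub>m (D * M * D)"
  proof (rule eq_matI)
    fix i j
    assume "i < dim_row ((- 1) \<cdot>\<^sub>m (D * M * D))" "j < dim_col ((- 1) \<cdot>\<^sub>m (D * M * D))"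
    then have ij: "i < n" "j < n"
      using D by auto
    show "map_mat (\<lambda>q. q \<circ>\<^sub>p [:0, - 1:]) M $$ (i, j) = ((- 1) \<cdot>\<^sub>m (D * M * D)) $$ (i, j)"
      \<comment> \<open>A nonzero entry has \<open>d i * d j = - 1\<close> and lies off the
        diagonal; a zero entry leaves at most the diagonal \<open>x\<close>, where
        \<open>d i * d i = 1\<close>.\<close>
      using ij M c[OF ij] unfolding DMD
      by (cases "A $$ (i, j) = 0")
        (auto simp: M_index d_def pcompose_pCons one_pCons)
  qed (use D M in auto)
  then have "det M \<circ>\<^sub>p [:0, - 1:] = det ((- 1) \<cdot>\<^sub>m (D * M * D))"
    by (metis comm_ring_hom.hom_det[OF pcompose_hom.comm_ring_hom_axioms])
  also have "\<dots> = (- 1) ^ n * (det D * det M * det D)"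
    using D by (simp add: det_mult[OF DM D] det_mult[OF D M])
  also have "\<dots> = (- 1) ^ n * det M * (det D * det D)"
    by (simp only: mult_ac)
  also have "\<dots> = Polynomial.smult ((- 1) ^ n) (det M)"
    by (simp only: detD) (cases "even n"; simp)
  finally show ?thesis
    by (simp add: M_def char_poly_def)
qed

section \<open>Cycles given by vertex lists\<close>

lemma pcas_vwalk_arcs:
  "xs \<noteq> [] \<Longrightarrow> pcas (hd xs) (vwalk_arcs xs) (last xs)"
  by (induction xs rule: vwalk_arcs.induct) auto

lemma pawalk_verts_vwalk_arcs:
  "xs \<noteq> [] \<Longrightarrow> pawalk_verts (hd xs) (vwalk_arcs xs) = xs"
  by (induction xs rule: vwalk_arcs.induct) auto

lemma length_vwalk_arcs: "length (vwalk_arcs xs) = length xs - 1"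
  by (simp flip: vwalk_length_def)

lemma set_vwalk_arcs_append:
  "set (vwalk_arcs (xs @ x # ys)) = set (vwalk_arcs (xs @ [x])) \<union> set (vwalk_arcs (x # ys))"
  by (induction xs rule: vwalk_arcs.induct) auto

text \<open>The closed list has as many arcs as \<open>xs\<close> has vertices, so the bound 3 on
  arcs in the definition of a tree becomes a bound on vertices.\<close>

lemma (in pair_wf_digraph) cycle_vwalk_arcs:
  assumes "distinct xs" "xs \<noteq> []" "set (vwalk_arcs (xs @ [hd xs])) \<subseteq> parcs G"
  shows "cycle (vwalk_arcs (xs @ [hd xs]))"
proof -
  let ?ys = "xs @ [hd xs]"
  have "hd ?ys = hd xs" "last ?ys = hd xs"
    using assms(2) by auto
  then have "pcas (hd xs) (vwalk_arcs ?ys) (hd xs)"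
    and verts: "pawalk_verts (hd xs) (vwalk_arcs ?ys) = ?ys"
    using pcas_vwalk_arcs[of ?ys] pawalk_verts_vwalk_arcs[of ?ys] by auto
  \<comment> \<open>A walk must start at a vertex of the graph; the arc leaving \<open>hd xs\<close>
    guarantees this.\<close>
  moreover obtain y where "(hd xs, y) \<in> set (vwalk_arcs ?ys)"
    using assms(2) by (cases xs; cases "tl xs") auto
  then have "hd xs \<in> pverts G"
    using assms(3) by (auto dest: in_arcsD1)
  ultimately have "awalk (hd xs) (vwalk_arcs ?ys) (hd xs)"
    using assms(3) by (simp add: awalk_def)
  moreover have "distinct (tl ?ys)"
    using assms(1,2) by (cases xs) auto
  moreover have "vwalk_arcs ?ys \<noteq> []"
    using assms(2) length_vwalk_arcs[of ?ys] by auto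
  ultimately show ?thesis
    using verts unfolding cycle_def by auto
qed

section \<open>Forests: short cycles, leaves, 2-colourings and stars\<close>

locale pair_forest = pair_graph +
  assumes acyclic: "\<not> (\<exists>p. cycle p \<and> 3 \<le> length p)"
begin

lemma no_closed_path:
  assumes "distinct xs" "3 \<le> length xs"
  shows "\<not> set (vwalk_arcs (xs @ [hd xs])) \<subseteq> parcs G"
proof
  assume "set (vwalk_arcs (xs @ [hd xs])) \<subseteq> parcs G"
  then have "cycle (vwalk_arcs (xs @ [hd xs]))"
    using assms by (intro cycle_vwalk_arcs) auto
  then show False
    using acyclic assms(2) by (auto simp: length_vwalk_arcs)
qed

lemma no_triangle:
  assumes "(a, b) \<in> parcs G" "(b, c) \<in> parcs G" "(c, a) \<in> parcs G"
  shows False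
  using no_closed_path[of "[a, b, c]"] assms no_loops by fastforce

text \<open>Neighbouring corners differ because there are no loops, so distinctness is assumed for
  opposite corners only.\<close>

lemma no_square:
  assumes "(a, b) \<in> parcs G" "(b, c) \<in> parcs G" "(c, d) \<in> parcs G" "(d, a) \<in> parcs G"
    and "a \<noteq> c" "b \<noteq> d"
  shows False
  using no_closed_path[of "[a, b, c, d]"] assms no_loops by fastforce

text \<open>
  The first vertex of a longest path in \<open>S\<close> will do: a second neighbour in \<open>S\<close> would lie on the path
  and close a cycle.
\<close>

lemma exists_leaf:
  assumes "finite S" "S \<noteq> {}"
  shows "\<exists>x\<in>S. \<exists>y. \<forall>z\<in>S. (x, z) \<in> parcs G \<longrightarrow> z = y"
proof (rule ccontr)
  assume "\<not> ?thesis"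
  then have branch: "\<exists>z\<in>S. (x, z) \<in> parcs G \<and> z \<noteq> y" if "x \<in> S" for x y
    using that by blast
  define P where
    "P xs \<longleftrightarrow> xs \<noteq> [] \<and> distinct xs \<and> set xs \<subseteq> S \<and> set (vwalk_arcs xs) \<subseteq> parcs G" for xs
  obtain s where "s \<in> S"
    using assms(2) by auto
  then have "P [s]"
    by (simp add: P_def)
  \<comment> \<open>A path in \<open>S\<close> repeats no vertex, so lengths are bounded and a
    longest path exists.\<close>
  moreover have "length xs < Suc (card S)" if "P xs" for xs
    using that card_mono[OF assms(1), of "set xs"] by (simp add: P_def distinct_card)
  ultimately obtain xs where xs: "P xs" and longest: "\<And>ys. P ys \<Longrightarrow> length ys \<le> length xs"
    using ex_has_greatest_nat[of P "[s]" length "Suc (card S)"] by blast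
  obtain x as where xas: "xs = x # as"
    using xs by (cases xs) (auto simp: P_def)
  \<comment> \<open>The new neighbour avoids the second vertex of the path; on a one-vertex path
    \<open>hd as\<close> is unspecified, hence the guard.\<close>
  obtain z where z: "z \<in> S" "(x, z) \<in> parcs G" "as \<noteq> [] \<Longrightarrow> z \<noteq> hd as"
    using branch[of x "hd as"] xs by (auto simp: P_def xas)
  have "(z, x) \<in> parcs G"
    using z(2) by (rule arcs_symmetric)
  have "z \<noteq> x"
    using z(2) no_loops by fastforce
  have "z \<in> set xs"
  proof (rule ccontr)
    assume "z \<notin> set xs"
    then have "P (z # xs)"
      using xs z(1) \<open>(z, x) \<in> parcs G\<close> by (auto simp: P_def xas)
    then show False
      using longest by fastforce
  qed
  then obtain bs cs where bcs: "as = bs @ z # cs"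
    using \<open>z \<noteq> x\<close> by (auto simp: xas in_set_conv_decomp)
  \<comment> \<open>As \<open>z\<close> is not the second vertex, the cycle through
    \<open>x\<close>, \<open>bs\<close> and \<open>z\<close> has at least three vertices.\<close>
  then have "bs \<noteq> []"
    using z(3) by auto
  define ys where "ys = (x # bs) @ [z]"
  have "set (vwalk_arcs ys) \<subseteq> parcs G"
    using xs set_vwalk_arcs_append[of "x # bs" z cs] unfolding P_def xas bcs ys_def
    by (simp only: append_Cons) blast
  then have "set (vwalk_arcs (ys @ [hd ys])) \<subseteq> parcs G"
    using set_vwalk_arcs_append[of "x # bs" z "[x]"] \<open>(z, x) \<in> parcs G\<close> by (auto simp: ys_def)
  moreover have "distinct ys"
    using xs by (auto simp: P_def xas bcs ys_def)
  moreover have "3 \<le> length ys"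
    using \<open>bs \<noteq> []\<close> by (cases bs) (auto simp: ys_def)
  ultimately show False
    using no_closed_path by blast
qed

text \<open>Remove a vertex with at most one neighbour in \<open>S\<close>, colour the rest, and
  give it the colour opposite to that neighbour. Ranging over vertex sets keeps the graph fixed
  during the induction.\<close>

lemma two_colourable_on:
  assumes "finite S"
  shows "\<exists>c :: 'a \<Rightarrow> bool. \<forall>x\<in>S. \<forall>y\<in>S. (x, y) \<in> parcs G \<longrightarrow> c x \<noteq> c y"
  using assms
proof (induction S rule: finite_psubset_induct)
  case (psubset S)
  show ?case
  proof (cases "S = {}")
    case False
    then obtain x y where xy: "x \<in> S" "\<And>z. z \<in> S \<Longrightarrow> (x, z) \<in> parcs G \<Longrightarrow> z = y"
      using exists_leaf[OF psubset.hyps(1)] by blast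
    obtain c :: "'a \<Rightarrow> bool"
      where c: "\<forall>u\<in>S - {x}. \<forall>v\<in>S - {x}. (u, v) \<in> parcs G \<longrightarrow> c u \<noteq> c v"
      using psubset.IH[of "S - {x}"] xy(1) by blast
    have "(c(x := \<not> c y)) u \<noteq> (c(x := \<not> c y)) v"
      if uv: "u \<in> S" "v \<in> S" "(u, v) \<in> parcs G" for u v
    proof -
      have "u \<noteq> v"
        using uv(3) no_loops by fastforce
      moreover have "v = y" if "u = x"
        using xy(2) uv(2,3) that by blast
      moreover have "u = y" if "v = x"
        using xy(2) uv(1) arcs_symmetric[OF uv(3)] that by blast
      moreover have "c u \<noteq> c v" if "u \<noteq> x" "v \<noteq> x"
        using c uv that by blast
      ultimately show ?thesis
        by (cases "u = x"; cases "v = x") auto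
    qed
    then show ?thesis
      by blast
  qed simp
qed

text \<open>An edge avoiding \<open>w\<close> would form a triangle with \<open>w\<close>. Used
  contrapositively: outside the star case every vertex has a non-neighbour other than
  itself.\<close>

lemma dominating_vertex_imp_star:
  assumes "w \<in> pverts G" and "\<And>x. x \<in> pverts G \<Longrightarrow> x \<noteq> w \<Longrightarrow> (w, x) \<in> parcs G"
  shows "complete_bipartite_digraph 1 (card (pverts G) - 1) (with_proj G)"
proof -
  have "parcs G = {w} \<times> (pverts G - {w}) \<union> (pverts G - {w}) \<times> {w}" (is "_ = ?R")
  proof
    show "parcs G \<subseteq> ?R"
    proof
      fix e
      assume e: "e \<in> parcs G"
      obtain u v where uv: "e = (u, v)"
        by (cases e)
      have "u \<noteq> v" "u \<in> pverts G" "v \<in> pverts G"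
        using e no_loops[of e] by (auto simp: uv dest: in_arcsD1 in_arcsD2)
      moreover have "u = w \<or> v = w"
        using no_triangle[of w u v] assms(2) calculation e arcs_symmetric by (auto simp: uv)
      ultimately show "e \<in> ?R"
        by (auto simp: uv)
    qed
    show "?R \<subseteq> parcs G"
      using assms(2) arcs_symmetric by auto
  qed
  moreover have "card (pverts G - {w}) = card (pverts G) - 1" "card {w} = 1"
    using assms(1) by simp_all
  ultimately show ?thesis
    unfolding complete_bipartite_digraph_pair_def
    by (intro conjI exI[of _ "{w}"] exI[of _ "pverts G - {w}"] pair_finite_verts)
      (use assms(1) in \<open>simp_all add: insert_absorb\<close>)
qed

end

section \<open>Distances with unit weights\<close>

lemma pair_wf_digraph_complement_graph: "pair_wf_digraph (complement_graph G)"
  by unfold_locales (auto simp: complement_graph_def)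

context wf_digraph
begin

lemma awalk_cost_one: "awalk_cost (\<lambda>_. 1) p = real (length p)"
  by (induction p) auto

lemma \<mu>_one_ge:
  assumes "\<And>p. awalk u p v \<Longrightarrow> k \<le> length p"
  shows "ereal (real k) \<le> \<mu> (\<lambda>_. 1) u v"
  unfolding \<mu>_def using assms by (auto intro!: INF_greatest simp: awalk_cost_one)

lemma \<mu>_one_le:
  assumes "awalk u p v"
  shows "\<mu> (\<lambda>_. 1) u v \<le> ereal (real (length p))"
  using min_cost_le_walk_cost[OF assms, of "\<lambda>_. 1"] by (simp add: awalk_cost_one)

lemma graph_dist_eq:
  assumes "awalk u p v" "\<And>q. awalk u q v \<Longrightarrow> length p \<le> length q"
  shows "graph_dist G u v = length p"
  using antisym[OF \<mu>_one_le[OF assms(1)] \<mu>_one_ge[OF assms(2)]] by (simp add: graph_dist_def)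

text \<open>Reachability excludes the default \<open>real_of_ereal \<infinity> = 0\<close>, which
  would violate any positive lower bound.\<close>

lemma graph_dist_ge:
  assumes "u \<rightarrow>\<^sup>* v" "\<And>p. awalk u p v \<Longrightarrow> k \<le> length p"
  shows "real k \<le> graph_dist G u v"
proof -
  have "ereal (real k) \<le> \<mu> (\<lambda>_. 1) u v" "\<mu> (\<lambda>_. 1) u v < \<infinity>"
    using \<mu>_one_ge assms \<mu>_reach_conv by auto
  then show ?thesis
    unfolding graph_dist_def by (cases "\<mu> (\<lambda>_. 1) u v") auto
qed

lemma graph_dist_self:
  assumes "u \<in> verts G"
  shows "graph_dist G u u = 0"
  using graph_dist_eq[of u "[]" u] assms by (simp add: awalk_Nil_iff)

lemma graph_dist_adjacent:
  assumes "u \<noteq> v" "(u, v) \<in> arcs_ends G"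
  shows "graph_dist G u v = 1"
proof -
  obtain e where e: "e \<in> arcs G" "tail G e = u" "head G e = v"
    using assms(2) by (auto simp: arcs_ends_conv)
  then have "awalk u [e] v"
    by (auto simp: awalk_simps)
  then show ?thesis
    using graph_dist_eq[of u "[e]" v] assms(1)
    by (fastforce simp: awalk_Nil_iff Suc_le_eq)
qed

lemma graph_dist_nonadjacent_ge:
  assumes "u \<rightarrow>\<^sup>* v" "u \<noteq> v" "(u, v) \<notin> arcs_ends G"
  shows "2 \<le> graph_dist G u v"
proof -
  have "2 \<le> length p" if "awalk u p v" for p
  proof (rule ccontr)
    assume "\<not> 2 \<le> length p"
    then consider "p = []" | e where "p = [e]"
      by (cases p; cases "tl p") auto
    then show False
      using that assms(2,3) by cases (auto simp: awalk_simps arcs_ends_conv)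
  qed
  then show ?thesis
    using graph_dist_ge[OF assms(1), of 2] by simp
qed

end

lemma (in fin_digraph) eccentricity_ge:
  assumes "v \<in> verts G"
  shows "graph_dist G u v \<le> eccentricity G u"
  unfolding eccentricity_def using assms by (intro Max_ge) auto

section \<open>Support of the eccentricity matrix of the complement\<close>

context pair_forest
begin

text \<open>
  Two adjacent vertices \<open>u\<close>, \<open>w\<close> have in the complement either a common neighbour
  or, for further neighbours \<open>a\<close> of \<open>u\<close> and \<open>b\<close> of \<open>w\<close>, the path \<open>u, b, a, w\<close>.
\<close>

lemma reachable_complement_graph:
  assumes not_star: "\<not> complete_bipartite_digraph 1 (card (pverts G) - 1) (with_proj G)"
    and uw: "(u, w) \<in> parcs G"
  shows "u \<rightarrow>\<^sup>*\<^bsub>with_proj (complement_graph G)\<^esub> w"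
proof -
  interpret C: pair_wf_digraph "complement_graph G"
    by (rule pair_wf_digraph_complement_graph)
  have C_arc: "x \<rightarrow>\<^sup>*\<^bsub>with_proj (complement_graph G)\<^esub> y"
    if "x \<in> pverts G" "y \<in> pverts G" "x \<noteq> y" "(x, y) \<notin> parcs G" for x y
    using that by (intro C.reachable_adjI) (simp add: complement_graph_def)
  have V: "u \<in> pverts G" "w \<in> pverts G" "u \<noteq> w"
    using uw no_loops[of "(u, w)"] by (auto dest: in_arcsD1 in_arcsD2)
  have wu: "(w, u) \<in> parcs G"
    using uw by (rule arcs_symmetric)
  show ?thesis
  proof (cases "\<exists>x\<in>pverts G. x \<noteq> u \<and> x \<noteq> w \<and> (u, x) \<notin> parcs G \<and> (x, w) \<notin> parcs G")
    case True
    then obtain x where "x \<in> pverts G" "x \<noteq> u" "x \<noteq> w" "(u, x) \<notin> parcs G" "(x, w) \<notin> parcs G"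
      by blast
    then show ?thesis
      using C.reachable_trans[OF C_arc[of u x] C_arc[of x w]] V by simp
  next
    case False
    \<comment> \<open>Without a common neighbour in the complement, every other vertex is adjacent
      in the forest to \<open>u\<close> or to \<open>w\<close>.\<close>
    then have dom: "(u, x) \<in> parcs G \<or> (x, w) \<in> parcs G"
      if "x \<in> pverts G" "x \<noteq> u" "x \<noteq> w" for x
      using that by blast
    obtain b where b: "b \<in> pverts G" "b \<noteq> u" "(u, b) \<notin> parcs G"
      using dominating_vertex_imp_star[OF V(1)] not_star by blast
    obtain a where a: "a \<in> pverts G" "a \<noteq> w" "(w, a) \<notin> parcs G"
      using dominating_vertex_imp_star[OF V(2)] not_star by blast
    have "b \<noteq> w" "a \<noteq> u"
      using a(3) b(3) uw wu by auto
    have bw: "(b, w) \<in> parcs G"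
      using dom[OF b(1,2) \<open>b \<noteq> w\<close>] b(3) by blast
    have ua: "(u, a) \<in> parcs G"
      using dom[OF a(1) \<open>a \<noteq> u\<close> a(2)] a(3) arcs_symmetric by blast
    \<comment> \<open>This edge would close the 4-cycle \<open>u, w, b, a\<close> in the
      forest.\<close>
    have "(b, a) \<notin> parcs G"
      using no_square[of u w b a] uw bw ua V \<open>a \<noteq> u\<close> b(2) a(2) arcs_symmetric by blast
    moreover have "a \<noteq> b"
      using ua b(3) by blast
    moreover have "(a, w) \<notin> parcs G"
      using a(3) arcs_symmetric by blast
    ultimately show ?thesis
      using C.reachable_trans[OF C.reachable_trans[OF C_arc[of u b] C_arc[of b a]] C_arc[of a w]]
        V a b by simp
  qed
qed

lemma ecc_entry_complement_graph:
  assumes not_star: "\<not> complete_bipartite_digraph 1 (card (pverts G) - 1) (with_proj G)"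
    and no_isolated: "\<And>x. x \<in> pverts G \<Longrightarrow> \<exists>y. (x, y) \<in> parcs G"
    and uv: "u \<in> pverts G" "v \<in> pverts G"
    and nz: "ecc_entry (with_proj (complement_graph G)) u v \<noteq> 0"
  shows "(u, v) \<in> parcs G"
proof (rule ccontr)
  assume nadj: "(u, v) \<notin> parcs G"
  let ?C = "with_proj (complement_graph G)"
  interpret C: pair_wf_digraph "complement_graph G"
    by (rule pair_wf_digraph_complement_graph)
  have vertsC [simp]: "pverts (complement_graph G) = pverts G"
    by (simp add: complement_graph_def)
  \<comment> \<open>Finiteness makes the \<open>Max\<close> in \<open>eccentricity\<close> an upper
    bound.\<close>
  have "finite (parcs (complement_graph G))"
    by (rule finite_subset[of _ "pverts G \<times> pverts G"])
      (auto simp: complement_graph_def pair_finite_verts)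
  then interpret C: pair_fin_digraph "complement_graph G"
    by unfold_locales (simp_all add: pair_finite_verts)
  have ecc: "2 \<le> eccentricity ?C x" if x: "x \<in> pverts G" for x
  proof -
    obtain y where y: "(x, y) \<in> parcs G"
      using no_isolated[OF x] by blast
    then have "x \<noteq> y" "y \<in> pverts G"
      using no_loops[of "(x, y)"] by (auto dest: in_arcsD2)
    moreover have "(x, y) \<notin> parcs (complement_graph G)"
      using y by (simp add: complement_graph_def)
    ultimately have "2 \<le> graph_dist ?C x y"
      using C.graph_dist_nonadjacent_ge[OF reachable_complement_graph[OF not_star y]] by simp
    also have "\<dots> \<le> eccentricity ?C x"
      using C.eccentricity_ge[of y x] \<open>y \<in> pverts G\<close> by simp
    finally show ?thesis .
  qed
  show False
  proof (cases "u = v")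
    case True
    then show False
      using nz C.graph_dist_self[of u] uv by (simp add: ecc_entry_def split: if_splits)
  next
    case False
    then have "graph_dist ?C u v = 1"
      using C.graph_dist_adjacent[of u v] uv nadj by (simp add: complement_graph_def)
    \<comment> \<open>Distance 1 lies below both eccentricities, so the entry takes its default
      0.\<close>
    then show False
      using nz ecc[OF uv(1)] ecc[OF uv(2)] by (auto simp: ecc_entry_def min_def split: if_splits)
  qed
qed

end

text \<open>Connectedness of the tree enters the argument here. For symmetric arcs it is strong
  connectedness, and the first arc of a walk to another vertex gives the neighbour.\<close>

lemma (in pair_graph) connected_imp_no_isolated:
  assumes "Digraph_Component.connected (with_proj G)" "2 \<le> card (pverts G)" "u \<in> pverts G"
  shows "\<exists>v. (u, v) \<in> parcs G"
proof -
  have "\<not> pverts G \<subseteq> {u}"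
    using card_mono[of "{u}" "pverts G"] assms(2) by auto
  then obtain v where "v \<in> pverts G" "v \<noteq> u"
    by blast
  moreover have "strongly_connected (with_proj G)"
    using symmetric_connected_imp_strongly_connected[OF sym_arcs assms(1)] by simp
  ultimately have "u \<rightarrow>\<^sup>*\<^bsub>with_proj G\<^esub> v"
    using assms(3) by (auto simp: strongly_connected_def)
  then obtain p where p: "awalk u p v"
    by (auto simp: reachable_awalk)
  then show ?thesis
    using \<open>v \<noteq> u\<close> by (cases p) (auto simp: awalk_simps)
qed

theorem theorem3p6:
  fixes T :: "'a pair_pre_digraph" and n k :: nat and vs :: "'a list" and l :: real
  assumes "undirected_tree (with_proj T)"
    and "card (pverts T) = n" and "n \<ge> 4"
    and "\<not> complete_bipartite_digraph 1 (n - 1) (with_proj T)"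
    and "distinct vs" and "set vs = pverts T"
    and "eigenvalue (ecc_matrix (with_proj (complement_graph T)) vs) l"
    and "Polynomial.order l (char_poly (ecc_matrix (with_proj (complement_graph T)) vs)) = k"
  shows "eigenvalue (ecc_matrix (with_proj (complement_graph T)) vs) (- l) \<and>
    Polynomial.order (- l) (char_poly (ecc_matrix (with_proj (complement_graph T)) vs)) = k"
proof -
  let ?A = "ecc_matrix (with_proj (complement_graph T)) vs"
  let ?p = "char_poly ?A"
  have "pair_graph T"
    using assms(1) by (simp add: undirected_tree_def pair_graphI_graph)
  then interpret pair_graph T .
  interpret pair_forest T
    using assms(1) by unfold_locales (simp add: undirected_tree_def)
  obtain c :: "'a \<Rightarrow> bool" where c: "\<forall>x\<in>pverts T. \<forall>y\<in>pverts T. (x, y) \<in> parcs T \<longrightarrow> c x \<noteq> c y"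
    using two_colourable_on[OF pair_finite_verts] by blast
  have A: "?A \<in> carrier_mat (length vs) (length vs)"
    by (simp add: ecc_matrix_def)
  have "c (vs ! i) \<noteq> c (vs ! j)"
    if ij: "i < length vs" "j < length vs" "?A $$ (i, j) \<noteq> 0" for i j
  proof -
    have V: "vs ! i \<in> pverts T" "vs ! j \<in> pverts T"
      using nth_mem[OF ij(1)] nth_mem[OF ij(2)] by (simp_all add: assms(6))
    moreover have "(vs ! i, vs ! j) \<in> parcs T"
    proof (rule ecc_entry_complement_graph[OF _ _ V])
      show "\<not> complete_bipartite_digraph 1 (card (pverts T) - 1) (with_proj T)"
        using assms(2,4) by simp
      show "\<exists>y. (x, y) \<in> parcs T" if "x \<in> pverts T" for x
        using connected_imp_no_isolated[OF _ _ that] assms(1-3) by (simp add: undirected_tree_def)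
      show "ecc_entry (with_proj (complement_graph T)) (vs ! i) (vs ! j) \<noteq> 0"
        using ij by (simp add: ecc_matrix_def)
    qed
    ultimately show ?thesis
      using c by blast
  qed
  then have "?p \<circ>\<^sub>p [:0, - 1:] = Polynomial.smult ((- 1) ^ length vs) ?p"
    using char_poly_pcompose_uminus[OF A, of "\<lambda>i. c (vs ! i)"] by blast
  \<comment> \<open>The characteristic polynomial is monic, so its root orders are genuine
    multiplicities.\<close>
  moreover have p: "?p \<noteq> 0"
    using degree_monic_char_poly[OF A] by auto
  ultimately have order: "Polynomial.order (- l) ?p = Polynomial.order l ?p"
    by (intro order_uminus_eq) auto
  \<comment> \<open>The order at the eigenvalue \<open>l\<close> is positive, hence so is the order
    at \<open>- l\<close>, which is therefore a root.\<close>
  then have "eigenvalue ?A (- l)"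
    using assms(7) p by (simp add: eigenvalue_root_char_poly[OF A] order_root)
  then show ?thesis
    using order assms(8) by simp
qed

end
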